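(* Let $F:[0,T)\times S^1\to\mathbb{R}^2$ be a smooth solution of the normal hyperbolic mean curvature flow (HMCF') (with $n=1$) whose initial curve $C=F(0,S^1)\subset\mathbb{R}^2$ is a closed immersed curve with non-vanishing rotation number $\chi(C)$. Then $T<\infty$.
   Context: $F$ is a smooth family of immersions of the circle in $\mathbb{R}^2$. $\frac{d}{dt}$ is the time derivative at a fixed point of $S^1$; $\nu$ is a unit normal along the curve, depending smoothly on $(t,x)$; $H$ is the curvature with respect to $\nu$, i.e. $\Delta F=H\nu$, with $\Delta$ the Laplacian (second arclength derivative) of the induced metric; $d\mu_t$ is the induced length element; $e=\frac12\left(\left|\frac{dF}{dt}\right|^2+1\right)$; $\nabla e$ is the (tangential) gradient of $e$ along the curve, regarded as a vector in $\mathbb{R}^2$. The equation (HMCF') is $$\frac{d^2}{dt^2}F=e\,H\nu-\nabla e,\qquad \left(\frac{dF}{dt}\right)^{\top}\Big|_{t=0}=0,$$ where $\top$ denotes the tangential part. The rotation number of a closed curve $C$ is $\chi(C)=\frac1{2\pi}\int_CH\,d\mu$. *)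

theory Defs
  imports "HOL-Analysis.Analysis"
begin

text \<open>
  Maps on the circle are represented as \<open>2\<pi>\<close>-periodic maps on the real line, i.e.\ the circle is
  \<open>\<real>/2\<pi>\<int>\<close> with angular coordinate \<open>x\<close>. A time-dependent map on the circle is a function of
  \<open>(t, x)\<close>; only its values for \<open>t\<close> in the time interval are relevant.
\<close>

definition time_interval :: "ereal \<Rightarrow> real set" where
  "time_interval T = {t. 0 \<le> t \<and> ereal t < T}"

text \<open>
  Derivatives are taken within \<open>S\<close>, so on \<open>[0,T) \<times> \<real>\<close> smoothness includes one-sided smoothness
  up to \<open>t = 0\<close>. Meant for sets on which derivatives within \<open>S\<close> are unique, such as convex
  sets with nonempty interior.
\<close>

primrec Ck_on :: "nat \<Rightarrow> 'a::real_normed_vector set \<Rightarrow> ('a \<Rightarrow> 'b::real_normed_vector) \<Rightarrow> bool" where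
  "Ck_on 0 S f \<longleftrightarrow> continuous_on S f"
| "Ck_on (Suc k) S f \<longleftrightarrow>
     f differentiable_on S \<and>
     (\<forall>v. Ck_on k S (\<lambda>p. frechet_derivative f (at p within S) v))"

definition smooth_on :: "'a::real_normed_vector set \<Rightarrow> ('a \<Rightarrow> 'b::real_normed_vector) \<Rightarrow> bool" where
  "smooth_on S f \<longleftrightarrow> (\<forall>k. Ck_on k S f)"

definition smooth_circle_family ::
  "ereal \<Rightarrow> (real \<Rightarrow> real \<Rightarrow> 'b::real_normed_vector) \<Rightarrow> bool" where
  "smooth_circle_family T f \<longleftrightarrow>
     smooth_on (time_interval T \<times> UNIV) (\<lambda>(t, x). f t x) \<and>
     (\<forall>t\<in>time_interval T. \<forall>x. f t (x + 2 * pi) = f t x)"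

text \<open>One-sided at \<open>t = 0\<close>.\<close>

definition dt :: "ereal \<Rightarrow> (real \<Rightarrow> real \<Rightarrow> 'b::real_normed_vector) \<Rightarrow> real \<Rightarrow> real \<Rightarrow> 'b" where
  "dt T f t x = vector_derivative (\<lambda>s. f s x) (at t within time_interval T)"

definition dx :: "(real \<Rightarrow> real \<Rightarrow> 'b::real_normed_vector) \<Rightarrow> real \<Rightarrow> real \<Rightarrow> 'b" where
  "dx f t x = vector_derivative (f t) (at x)"

definition smooth_immersions :: "ereal \<Rightarrow> (real \<Rightarrow> real \<Rightarrow> real^2) \<Rightarrow> bool" where
  "smooth_immersions T F \<longleftrightarrow>
     smooth_circle_family T F \<and> (\<forall>t\<in>time_interval T. \<forall>x. dx F t x \<noteq> 0)"

definition smooth_unit_normal ::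
  "ereal \<Rightarrow> (real \<Rightarrow> real \<Rightarrow> real^2) \<Rightarrow> (real \<Rightarrow> real \<Rightarrow> real^2) \<Rightarrow> bool" where
  "smooth_unit_normal T F \<nu> \<longleftrightarrow>
     smooth_circle_family T \<nu> \<and>
     (\<forall>t\<in>time_interval T. \<forall>x. norm (\<nu> t x) = 1 \<and> \<nu> t x \<bullet> dx F t x = 0)"

text \<open>
  The induced metric is \<open>|F\<^sub>x|\<^sup>2 dx\<^sup>2\<close>: arclength derivative \<open>|F\<^sub>x|\<^sup>-\<^sup>1 \<partial>\<^sub>x\<close>, length element
  \<open>|F\<^sub>x| dx\<close>, unit tangent \<open>|F\<^sub>x|\<^sup>-\<^sup>1 F\<^sub>x\<close>.
\<close>

definition ds ::
  "(real \<Rightarrow> real \<Rightarrow> real^2) \<Rightarrow> (real \<Rightarrow> real \<Rightarrow> 'b::real_normed_vector) \<Rightarrow> real \<Rightarrow> real \<Rightarrow> 'b" where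
  "ds F f t x = dx f t x /\<^sub>R norm (dx F t x)"

definition laplacian ::
  "(real \<Rightarrow> real \<Rightarrow> real^2) \<Rightarrow> (real \<Rightarrow> real \<Rightarrow> 'b::real_normed_vector) \<Rightarrow> real \<Rightarrow> real \<Rightarrow> 'b" where
  "laplacian F f = ds F (ds F f)"

definition grad :: "(real \<Rightarrow> real \<Rightarrow> real^2) \<Rightarrow> (real \<Rightarrow> real \<Rightarrow> real) \<Rightarrow> real \<Rightarrow> real \<Rightarrow> real^2" where
  "grad F f t x = ds F f t x *\<^sub>R ds F F t x"

definition tangential ::
  "(real \<Rightarrow> real \<Rightarrow> real^2) \<Rightarrow> (real \<Rightarrow> real \<Rightarrow> real^2) \<Rightarrow> real \<Rightarrow> real \<Rightarrow> real^2" where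
  "tangential F V t x = (V t x \<bullet> ds F F t x) *\<^sub>R ds F F t x"

definition curvature ::
  "(real \<Rightarrow> real \<Rightarrow> real^2) \<Rightarrow> (real \<Rightarrow> real \<Rightarrow> real^2) \<Rightarrow> real \<Rightarrow> real \<Rightarrow> real" where
  "curvature F \<nu> t x = (THE h. laplacian F F t x = h *\<^sub>R \<nu> t x)"

definition energy_density :: "ereal \<Rightarrow> (real \<Rightarrow> real \<Rightarrow> real^2) \<Rightarrow> real \<Rightarrow> real \<Rightarrow> real" where
  "energy_density T F t x = (1/2) * ((norm (dt T F t x))\<^sup>2 + 1)"

definition normal_HMCF ::
  "ereal \<Rightarrow> (real \<Rightarrow> real \<Rightarrow> real^2) \<Rightarrow> (real \<Rightarrow> real \<Rightarrow> real^2) \<Rightarrow> bool" where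
  "normal_HMCF T F \<nu> \<longleftrightarrow>
     (\<forall>t\<in>time_interval T. \<forall>x.
        dt T (dt T F) t x =
          (energy_density T F t x * curvature F \<nu> t x) *\<^sub>R \<nu> t x
          - grad F (energy_density T F) t x) \<and>
     (\<forall>x. tangential F (dt T F) 0 x = 0)"

definition rotation_number ::
  "(real \<Rightarrow> real \<Rightarrow> real^2) \<Rightarrow> (real \<Rightarrow> real \<Rightarrow> real^2) \<Rightarrow> real \<Rightarrow> real" where
  "rotation_number F \<nu> t =
     1 / (2 * pi) * integral {0..2 * pi} (\<lambda>x. curvature F \<nu> t x * norm (dx F t x))"

end

theory Submission
  imports Defs
begin

text \<open>
  The equation makes \<open>\<langle>F\<^sub>t, F\<^sub>x\<rangle>\<close> constant in time, so the velocity stays normal, \<open>F\<^sub>t = \<sigma>\<nu>\<close>, and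
  \<open>\<sigma>\<^sub>t = e H\<close> with \<open>e = (\<sigma>\<^sup>2 + 1)/2\<close>, while \<open>d\<mu>\<^sub>t = -\<sigma>H d\<mu>\<close>. Hence the energy element \<open>e d\<mu>\<close> is
  conserved pointwise. For \<open>\<Phi>(\<sigma>) = \<sigma> + (1 + \<sigma>\<^sup>2) arctan \<sigma>\<close> one finds \<open>(\<Phi>(\<sigma>) d\<mu>)\<^sub>t = H d\<mu>\<close>. Since the
  total curvature is constant in time, \<open>\<integral>\<Phi>(\<sigma>) d\<mu>\<close> grows linearly with slope \<open>2\<pi>\<chi>(C) \<noteq> 0\<close>; but
  \<open>|\<Phi>(\<sigma>)| \<le> (1 + \<pi>) e\<close> bounds it by the conserved energy, so the solution cannot exist for all time.
\<close>

section \<open>Smoothness on a set depends only on the values there\<close>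

text \<open>\<open>frechet_derivative\<close> is a choice among all derivatives within
  \<open>S\<close>. Both functions admit the same candidates, so the choice agrees even where
  derivatives might not be unique.\<close>

lemma frechet_derivative_within_cong:
  assumes "p \<in> S" "\<And>q. q \<in> S \<Longrightarrow> f q = g q"
  shows "frechet_derivative f (at p within S) = frechet_derivative g (at p within S)"
proof -
  have "(f has_derivative D) (at p within S) \<longleftrightarrow> (g has_derivative D) (at p within S)" for D
    using assms by (metis has_derivative_transform)
  then show ?thesis
    by (simp add: frechet_derivative_def)
qed

lemma Ck_on_cong:
  assumes "\<And>p. p \<in> S \<Longrightarrow> f p = g p"
  shows "Ck_on k S f \<longleftrightarrow> Ck_on k S g"
  using assms
proof (induction k arbitrary: f g)
  case 0
  then show ?case by (simp cong: continuous_on_cong)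
next
  case (Suc k)
  have "f differentiable_on S \<longleftrightarrow> g differentiable_on S"
    using Suc.prems by (simp add: differentiable_on_def differentiable_def)
      (metis (mono_tags, lifting) has_derivative_transform)
  moreover have "Ck_on k S (\<lambda>p. frechet_derivative f (at p within S) v) \<longleftrightarrow>
      Ck_on k S (\<lambda>p. frechet_derivative g (at p within S) v)" for v
    by (intro Suc.IH) (use Suc.prems frechet_derivative_within_cong in metis)
  ultimately show ?case by simp
qed

text \<open>Partial derivatives are identified with values of the Frechet derivative only at times
  in the interval; this transfers smoothness across that identification.\<close>

lemma smooth_on_cong:
  assumes "\<And>p. p \<in> S \<Longrightarrow> f p = g p"
  shows "smooth_on S f \<longleftrightarrow> smooth_on S g"
  unfolding smooth_on_def by (metis Ck_on_cong assms)

lemma smooth_on_imp_continuous_on: "smooth_on S f \<Longrightarrow> continuous_on S f"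
  unfolding smooth_on_def by (metis Ck_on.simps(1))

lemma smooth_on_imp_differentiable_on: "smooth_on S f \<Longrightarrow> f differentiable_on S"
  unfolding smooth_on_def by (metis Ck_on.simps(2))

lemma smooth_on_frechet_derivative:
  "smooth_on S f \<Longrightarrow> smooth_on S (\<lambda>p. frechet_derivative f (at p within S) v)"
  unfolding smooth_on_def by (metis Ck_on.simps(2))

section \<open>The time interval and partial derivatives on it\<close>

lemma zero_in_time_interval: "0 < T \<Longrightarrow> 0 \<in> time_interval T"
  by (simp add: time_interval_def zero_ereal_def)

lemma convex_time_interval: "convex (time_interval T)"
proof -
  have "is_interval (time_interval T)"
    unfolding is_interval_1 time_interval_def
    by (auto intro: order_trans) (metis ereal_less_eq(3) le_less_trans)
  then show ?thesis by (simp add: is_interval_convex_1)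
qed

text \<open>A connected set with two points has no isolated point, and \<open>0 < T\<close> supplies
  a second point besides 0. This makes time derivatives unique, including the one-sided one at time
  0.\<close>

lemma at_within_time_interval_neq_bot:
  assumes "0 < T" "t \<in> time_interval T"
  shows "at t within time_interval T \<noteq> bot"
proof -
  obtain u where u: "u \<in> time_interval T" "u \<noteq> 0"
  proof -
    obtain r where "0 < ereal r" "ereal r < T"
      using assms(1) ereal_dense2 zero_ereal_def by metis
    then show ?thesis
      by (intro that[of r]) (auto simp: time_interval_def)
  qed
  have "t islimpt time_interval T"
    using assms(2) u zero_in_time_interval[OF assms(1)]
    by (intro connected_imp_perfect convex_connected convex_time_interval) auto
  then show ?thesis
    by (simp add: trivial_limit_within)
qed

text \<open>Chain rule along the affine slices through \<open>(t, x)\<close>. The space slice is the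
  whole line, so the space derivative is two-sided even at \<open>t = 0\<close>.\<close>

lemma smooth_circle_family_frechet_has_vector_derivative:
  fixes x :: real
  assumes "smooth_circle_family T f" "t \<in> time_interval T"
  defines "S \<equiv> time_interval T \<times> UNIV"
  defines "D \<equiv> frechet_derivative (\<lambda>(t, x). f t x) (at (t, x) within S)"
  shows "((\<lambda>s. f s x) has_vector_derivative D (1, 0)) (at t within time_interval T)"
    and "(f t has_vector_derivative D (0, 1)) (at x)"
proof -
  have "(\<lambda>(t, x). f t x) differentiable (at (t, x) within S)"
    using assms smooth_on_imp_differentiable_on
    by (force simp: smooth_circle_family_def differentiable_on_def)
  then have D: "((\<lambda>(t, x). f t x) has_derivative D) (at (t, x) within S)"
    by (simp add: D_def frechet_derivative_works)
  interpret D: bounded_linear D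
    using D by (rule has_derivative_bounded_linear)
  have "((\<lambda>(t, x). f t x) \<circ> (\<lambda>s. (s, x)) has_derivative D \<circ> (\<lambda>h. (h, 0)))
      (at t within time_interval T)"
    by (rule diff_chain_within)
      (auto intro!: derivative_eq_intros has_derivative_subset[OF D] simp: S_def)
  moreover have "D \<circ> (\<lambda>h. (h, 0)) = (\<lambda>h. h *\<^sub>R D (1, 0))"
    by (simp add: fun_eq_iff flip: D.scaleR)
  ultimately show "((\<lambda>s. f s x) has_vector_derivative D (1, 0)) (at t within time_interval T)"
    by (auto simp: has_vector_derivative_def o_def)
  have "((\<lambda>(t, x). f t x) \<circ> (\<lambda>y. (t, y)) has_derivative D \<circ> (\<lambda>h. (0, h))) (at x)"
    by (rule diff_chain_within)
      (use assms(2) in \<open>auto intro!: derivative_eq_intros has_derivative_subset[OF D] simp: S_def\<close>)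
  moreover have "D \<circ> (\<lambda>h. (0, h)) = (\<lambda>h. h *\<^sub>R D (0, 1))"
    by (simp add: fun_eq_iff flip: D.scaleR)
  ultimately show "(f t has_vector_derivative D (0, 1)) (at x)"
    by (auto simp: has_vector_derivative_def o_def)
qed

lemma dt_eqI:
  assumes "0 < T" "t \<in> time_interval T"
    and "((\<lambda>s. f s x) has_vector_derivative D) (at t within time_interval T)"
  shows "dt T f t x = D"
  unfolding dt_def using assms at_within_time_interval_neq_bot vector_derivative_within by blast

lemma dx_eqI: "(f t has_vector_derivative D) (at x) \<Longrightarrow> dx f t x = D"
  unfolding dx_def by (rule vector_derivative_at)

lemma dt_eq_frechet_derivative:
  assumes "0 < T" "smooth_circle_family T f" "t \<in> time_interval T"
  shows "dt T f t x =
    frechet_derivative (\<lambda>(t, x). f t x) (at (t, x) within time_interval T \<times> UNIV) (1, 0)"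
  using assms by (intro dt_eqI smooth_circle_family_frechet_has_vector_derivative)

lemma dx_eq_frechet_derivative:
  assumes "smooth_circle_family T f" "t \<in> time_interval T"
  shows "dx f t x =
    frechet_derivative (\<lambda>(t, x). f t x) (at (t, x) within time_interval T \<times> UNIV) (0, 1)"
  using assms by (intro dx_eqI smooth_circle_family_frechet_has_vector_derivative)

lemma has_vector_derivative_dt:
  assumes "0 < T" "smooth_circle_family T f" "t \<in> time_interval T"
  shows "((\<lambda>s. f s x) has_vector_derivative dt T f t x) (at t within time_interval T)"
  using assms smooth_circle_family_frechet_has_vector_derivative(1)
  by (simp add: dt_eq_frechet_derivative)

lemma has_vector_derivative_dx:
  assumes "smooth_circle_family T f" "t \<in> time_interval T"
  shows "(f t has_vector_derivative dx f t x) (at x within X)"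
  using assms smooth_circle_family_frechet_has_vector_derivative(2)
  by (metis dx_eq_frechet_derivative has_vector_derivative_at_within)

text \<open>Together with its analogue for \<open>dx\<close>, this lets partial derivatives be
  iterated. Periodicity passes to the derivative by uniqueness.\<close>

lemma smooth_circle_family_dt:
  assumes "0 < T" "smooth_circle_family T f"
  shows "smooth_circle_family T (dt T f)"
  unfolding smooth_circle_family_def
proof (intro conjI ballI allI)
  let ?S = "time_interval T \<times> (UNIV :: real set)"
  have "smooth_on ?S (\<lambda>p. frechet_derivative (\<lambda>(t, x). f t x) (at p within ?S) (1, 0))"
    using assms by (intro smooth_on_frechet_derivative) (simp add: smooth_circle_family_def)
  also have "?this \<longleftrightarrow> smooth_on ?S (\<lambda>(t, x). dt T f t x)"
    using assms by (intro smooth_on_cong) (auto simp: dt_eq_frechet_derivative)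
  finally show "smooth_on ?S (\<lambda>(t, x). dt T f t x)" .
  fix t x assume t: "t \<in> time_interval T"
  have "((\<lambda>s. f s x) has_vector_derivative dt T f t (x + 2 * pi)) (at t within time_interval T)"
    by (rule has_vector_derivative_transform[OF t _ has_vector_derivative_dt[OF assms t]])
      (use assms(2) in \<open>auto simp: smooth_circle_family_def\<close>)
  then show "dt T f t (x + 2 * pi) = dt T f t x"
    using assms t by (metis dt_eqI)
qed

lemma smooth_circle_family_dx:
  assumes "smooth_circle_family T f"
  shows "smooth_circle_family T (dx f)"
  unfolding smooth_circle_family_def
proof (intro conjI ballI allI)
  let ?S = "time_interval T \<times> (UNIV :: real set)"
  have "smooth_on ?S (\<lambda>p. frechet_derivative (\<lambda>(t, x). f t x) (at p within ?S) (0, 1))"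
    using assms by (intro smooth_on_frechet_derivative) (simp add: smooth_circle_family_def)
  also have "?this \<longleftrightarrow> smooth_on ?S (\<lambda>(t, x). dx f t x)"
    using assms by (intro smooth_on_cong) (auto simp: dx_eq_frechet_derivative)
  finally show "smooth_on ?S (\<lambda>(t, x). dx f t x)" .
  fix t x assume t: "t \<in> time_interval T"
  have "(f t \<circ> (\<lambda>y. y + 2 * pi) has_vector_derivative 1 *\<^sub>R dx f t (x + 2 * pi)) (at x)"
    by (rule vector_diff_chain_at)
      (auto intro!: derivative_eq_intros has_vector_derivative_dx[OF assms t])
  moreover have "f t \<circ> (\<lambda>y. y + 2 * pi) = f t"
    using assms t by (auto simp: smooth_circle_family_def)
  ultimately show "dx f t (x + 2 * pi) = dx f t x"
    by (metis dx_eqI scaleR_one)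
qed

lemma smooth_circle_family_continuous_on:
  "smooth_circle_family T f \<Longrightarrow> continuous_on (time_interval T \<times> X) (\<lambda>(t, x). f t x)"
  unfolding smooth_circle_family_def
  by (meson Sigma_mono continuous_on_subset smooth_on_imp_continuous_on subset_UNIV subset_refl)

lemma smooth_circle_family_continuous_on_slice:
  assumes "smooth_circle_family T f" "t \<in> time_interval T"
  shows "continuous_on X (f t)"
  using has_vector_derivative_continuous[OF has_vector_derivative_dx[OF assms]]
  by (simp add: continuous_on_eq_continuous_within)

text \<open>
  Differentiating \<open>f(t,x) = f(t,a) + \<integral>\<^sub>a\<^sup>x f\<^sub>x\<close> in \<open>t\<close> under the integral and then in \<open>x\<close> gives
  symmetry up to the boundary of the time interval.
\<close>

lemma dt_dx_commute:
  fixes f :: "real \<Rightarrow> real \<Rightarrow> 'b::banach"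
  assumes T: "0 < T" and f: "smooth_circle_family T f" and t: "t \<in> time_interval T"
  shows "dx (dt T f) t x = dt T (dx f) t x"
proof -
  note fx = smooth_circle_family_dx[OF f]
  note fxt = smooth_circle_family_dt[OF T fx]
  \<comment> \<open>A base point strictly to the left of \<open>x\<close> makes \<open>x\<close>
    interior to \<open>{a..x + 1}\<close>, so the derivative obtained within that interval is
    two-sided.\<close>
  define a where "a = x - 1"
  have increment: "dt T f t y - dt T f t a = integral {a..y} (dt T (dx f) t)" if "a \<le> y" for y
  proof -
    have "((\<lambda>s. integral (cbox a y) (dx f s)) has_vector_derivative
        integral (cbox a y) (dt T (dx f) t)) (at t within time_interval T)"
    proof (rule leibniz_rule_vector_derivative)
      show "dx f s integrable_on cbox a y" if "s \<in> time_interval T" for s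
        by (intro integrable_continuous smooth_circle_family_continuous_on_slice[OF fx that])
      show "((\<lambda>s. dx f s z) has_vector_derivative dt T (dx f) s z) (at s within time_interval T)"
        if "s \<in> time_interval T" for s z
        by (rule has_vector_derivative_dt[OF T fx that])
    qed (rule smooth_circle_family_continuous_on[OF fxt] t convex_time_interval)+
    moreover have "integral (cbox a y) (dx f s) = f s y - f s a" if "s \<in> time_interval T" for s
      using fundamental_theorem_of_calculus[OF \<open>a \<le> y\<close>, of "f s" "dx f s"]
        has_vector_derivative_dx[OF f that] by (simp add: integral_unique)
    ultimately have "((\<lambda>s. f s y - f s a) has_vector_derivative
        integral (cbox a y) (dt T (dx f) t)) (at t within time_interval T)"
      by - (rule has_vector_derivative_transform[OF t,
            where f = "\<lambda>s. integral (cbox a y) (dx f s)"], simp_all)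
    moreover have "((\<lambda>s. f s y - f s a) has_vector_derivative dt T f t y - dt T f t a)
        (at t within time_interval T)"
      by (intro has_vector_derivative_diff has_vector_derivative_dt T f t)
    ultimately show ?thesis
      using vector_derivative_unique_within[OF at_within_time_interval_neq_bot[OF T t]]
      by (metis interval_cbox)
  qed
  let ?G = "\<lambda>y. dt T f t a + integral {a..y} (dt T (dx f) t)"
  have "(?G has_vector_derivative 0 + dt T (dx f) t x) (at x within {a..x + 1})"
    by (intro has_vector_derivative_add has_vector_derivative_const integral_has_vector_derivative
        smooth_circle_family_continuous_on_slice[OF fxt t]) (simp add: a_def)
  then have "(dt T f t has_vector_derivative 0 + dt T (dx f) t x) (at x within {a..x + 1})"
  proof (rule has_vector_derivative_transform[rotated 2])
    show "dt T f t y = ?G y" if "y \<in> {a..x + 1}" for y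
      using increment[of y] that by (simp add: diff_eq_eq add.commute)
  qed (simp add: a_def)
  moreover have "at x within {a..x + 1} = at x"
    by (rule at_within_interior) (simp add: a_def)
  ultimately show ?thesis
    by (simp add: dx_eqI)
qed

section \<open>Orthonormal frames in the plane and derivatives of norms\<close>

text \<open>A nonzero remainder \<open>r\<close> would be orthogonal to \<open>u\<close> and
  \<open>w\<close>, giving three independent vectors in dimension two.\<close>

lemma orthonormal_expansion_R2:
  fixes u w v :: "real^2"
  assumes "norm u = 1" "norm w = 1" "u \<bullet> w = 0"
  shows "v = (v \<bullet> u) *\<^sub>R u + (v \<bullet> w) *\<^sub>R w"
proof (rule ccontr)
  define r where "r = v - ((v \<bullet> u) *\<^sub>R u + (v \<bullet> w) *\<^sub>R w)"
  assume "v \<noteq> (v \<bullet> u) *\<^sub>R u + (v \<bullet> w) *\<^sub>R w"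
  then have r: "r \<noteq> 0" by (simp add: r_def)
  have uw: "u \<bullet> u = 1" "w \<bullet> w = 1" "w \<bullet> u = 0"
    using assms by (simp_all add: norm_eq_1 inner_commute)
  have "r \<bullet> u = 0" "r \<bullet> w = 0"
    using uw assms(3) by (simp_all add: r_def inner_diff_left inner_add_left)
  then have "pairwise orthogonal {u, w, r}" "0 \<notin> {u, w, r}" "card {u, w, r} = 3"
    using r uw assms(3) by (auto simp: pairwise_def orthogonal_def inner_commute card_insert_if)
  then have "card {u, w, r} \<le> 2"
    using pairwise_orthogonal_independent independent_bound by fastforce
  then show False
    using \<open>card {u, w, r} = 3\<close> by simp
qed

lemma has_vector_derivative_inner:
  assumes "(f has_vector_derivative f') (at t within S)" "(g has_vector_derivative g') (at t within S)"
  shows "((\<lambda>s. f s \<bullet> g s) has_real_derivative f t \<bullet> g' + f' \<bullet> g t) (at t within S)"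
  unfolding has_real_derivative_iff_has_vector_derivative
  by (rule bounded_bilinear.has_vector_derivative[OF bounded_bilinear_inner assms])

lemma has_real_derivative_norm:
  assumes "(u has_vector_derivative u') (at t within S)" "u t \<noteq> 0"
  shows "((\<lambda>s. norm (u s)) has_real_derivative (u t \<bullet> u') / norm (u t)) (at t within S)"
proof -
  have "((\<lambda>s. sqrt (u s \<bullet> u s)) has_real_derivative
      inverse (sqrt (u t \<bullet> u t)) / 2 * (u t \<bullet> u' + u' \<bullet> u t)) (at t within S)"
    using assms(2)
    by (intro DERIV_chain2[OF DERIV_real_sqrt has_vector_derivative_inner[OF assms(1,1)]]) simp
  moreover have "inverse (norm (u t)) / 2 * (u t \<bullet> u' + u' \<bullet> u t) = (u t \<bullet> u') / norm (u t)"
    by (simp add: inner_commute[of u'] inverse_eq_divide)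
  ultimately show ?thesis
    by (simp only: norm_eq_sqrt_inner)
qed

text \<open>Differentiate \<open>u s \<bullet> u s = 1\<close>. Only uniqueness of the derivative
  within \<open>S\<close> is asked for, so one-sided derivatives are covered.\<close>

lemma unit_vector_derivative_orthogonal:
  assumes "\<And>s. s \<in> S \<Longrightarrow> norm (u s) = 1" "t \<in> S" "at t within S \<noteq> bot"
    and "(u has_vector_derivative u') (at t within S)"
  shows "u' \<bullet> u t = 0"
proof -
  have "((\<lambda>s. u s \<bullet> u s) has_vector_derivative u t \<bullet> u' + u' \<bullet> u t) (at t within S)"
    using has_vector_derivative_inner[OF assms(4,4)]
    by (simp add: has_real_derivative_iff_has_vector_derivative)
  moreover have "((\<lambda>s. u s \<bullet> u s) has_vector_derivative 0) (at t within S)"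
    by (rule has_vector_derivative_transform[OF assms(2), where f = "\<lambda>_. 1"])
      (use assms(1) in \<open>simp_all add: norm_eq_1\<close>)
  ultimately have "u t \<bullet> u' + u' \<bullet> u t = 0"
    by (rule vector_derivative_unique_within[OF assms(3)])
  then show ?thesis
    by (simp add: inner_commute)
qed

text \<open>The value of \<open>D\<close> stays unspecified: for the unit tangent, differentiability
  and orthogonality to the tangent carry the later arguments.\<close>

lemma normalize_has_vector_derivative:
  fixes u :: "real \<Rightarrow> 'a::real_inner"
  assumes "(u has_vector_derivative u') (at t within S)" "u t \<noteq> 0"
  obtains D where "((\<lambda>s. u s /\<^sub>R norm (u s)) has_vector_derivative D) (at t within S)"
proof -
  have "((\<lambda>s. inverse (norm (u s))) has_real_derivative
      - (inverse (norm (u t)) * ((u t \<bullet> u') / norm (u t)) * inverse (norm (u t)))) (at t within S)"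
    using assms by (intro DERIV_inverse' has_real_derivative_norm) auto
  from has_vector_derivative_scaleR[OF this assms(1)] show ?thesis
    by (rule that)
qed

section \<open>The moving frame of a family of immersed circles\<close>

locale immersed_circle_family =
  fixes T :: ereal and F \<nu> :: "real \<Rightarrow> real \<Rightarrow> real^2"
  assumes T_pos: "0 < T"
    and immersions: "smooth_immersions T F"
    and unit_normal: "smooth_unit_normal T F \<nu>"
begin

abbreviation I where "I \<equiv> time_interval T"
abbreviation g where "g t x \<equiv> norm (dx F t x)"
abbreviation \<tau> where "\<tau> \<equiv> ds F F"

text \<open>The density of \<open>H d\<mu>\<close> with respect to \<open>dx\<close>.\<close>

definition \<kappa> where "\<kappa> t x = - (dx \<nu> t x \<bullet> \<tau> t x)"

lemma smooth_F: "smooth_circle_family T F"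
  using immersions by (simp add: smooth_immersions_def)

lemma smooth_\<nu>: "smooth_circle_family T \<nu>"
  using unit_normal by (simp add: smooth_unit_normal_def)

lemmas smooth_family_intros =
  smooth_F smooth_\<nu> smooth_circle_family_dx smooth_circle_family_dt[OF T_pos]

lemmas time_not_bot = at_within_time_interval_neq_bot[OF T_pos]

lemma zero_in_I: "0 \<in> I"
  by (rule zero_in_time_interval[OF T_pos])

lemma g_pos: "t \<in> I \<Longrightarrow> 0 < g t x"
  using immersions by (simp add: smooth_immersions_def)

lemma dx_F_eq: "t \<in> I \<Longrightarrow> dx F t x = g t x *\<^sub>R \<tau> t x"
  using g_pos[of t x] by (simp add: ds_def)

lemma inner_dx_F: "t \<in> I \<Longrightarrow> v \<bullet> dx F t x = g t x * (v \<bullet> \<tau> t x)"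
  by (subst dx_F_eq) simp_all

lemma norm_\<tau>: "t \<in> I \<Longrightarrow> norm (\<tau> t x) = 1"
  using g_pos[of t x] by (simp add: ds_def)

lemma norm_\<nu>: "t \<in> I \<Longrightarrow> norm (\<nu> t x) = 1"
  using unit_normal by (simp add: smooth_unit_normal_def)

lemma \<nu>_\<tau>: "t \<in> I \<Longrightarrow> \<nu> t x \<bullet> \<tau> t x = 0"
  using unit_normal by (simp add: smooth_unit_normal_def ds_def)

lemma frame_expansion:
  "t \<in> I \<Longrightarrow> v = (v \<bullet> \<nu> t x) *\<^sub>R \<nu> t x + (v \<bullet> \<tau> t x) *\<^sub>R \<tau> t x"
  by (intro orthonormal_expansion_R2 norm_\<nu> norm_\<tau> \<nu>_\<tau>)

text \<open>In the plane \<open>v\<close> is then a multiple of \<open>\<tau>\<close>. This removes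
  mixed terms pairing a derivative of \<open>\<nu>\<close> with a derivative of
  \<open>\<tau>\<close>.\<close>

lemma inner_eq_zero_if_orthogonal_normal:
  assumes "t \<in> I" "v \<bullet> \<nu> t x = 0" "w \<bullet> \<tau> t x = 0"
  shows "v \<bullet> w = 0"
  using frame_expansion[OF assms(1), of v x] assms(2,3)
  by (metis add_0 inner_commute inner_scaleR_left mult_zero_right scaleR_zero_left)

lemma \<tau>_has_time_derivative:
  assumes "t \<in> I"
  obtains D where "((\<lambda>s. \<tau> s x) has_vector_derivative D) (at t within I)" "D \<bullet> \<tau> t x = 0"
proof -
  obtain D where D: "((\<lambda>s. \<tau> s x) has_vector_derivative D) (at t within I)"
    unfolding ds_def
    by (rule normalize_has_vector_derivative[OF has_vector_derivative_dt[OF T_pos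
            smooth_circle_family_dx[OF smooth_F] assms]])
      (use g_pos[OF assms, of x] in auto)
  with assms show ?thesis
    by (intro that unit_vector_derivative_orthogonal[where S = I] norm_\<tau> time_not_bot)
qed

lemma \<tau>_has_dx:
  assumes "t \<in> I"
  shows "(\<tau> t has_vector_derivative dx \<tau> t x) (at x within X)" "dx \<tau> t x \<bullet> \<tau> t x = 0"
proof -
  obtain D where "((\<lambda>y. \<tau> t y) has_vector_derivative D) (at x)"
    unfolding ds_def
    by (rule normalize_has_vector_derivative[OF has_vector_derivative_dx[OF
            smooth_circle_family_dx[OF smooth_F] assms]])
      (use g_pos[OF assms, of x] in auto)
  then have D: "(\<tau> t has_vector_derivative dx \<tau> t x) (at x)"
    using dx_eqI by metis
  then show "(\<tau> t has_vector_derivative dx \<tau> t x) (at x within X)"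
    by (rule has_vector_derivative_at_within)
  show "dx \<tau> t x \<bullet> \<tau> t x = 0"
    by (rule unit_vector_derivative_orthogonal[where S = UNIV, OF _ _ _ D])
      (use assms norm_\<tau> in auto)
qed

lemma \<nu>_derivatives_orthogonal:
  assumes "t \<in> I"
  shows "dt T \<nu> t x \<bullet> \<nu> t x = 0" "dx \<nu> t x \<bullet> \<nu> t x = 0"
proof -
  show "dt T \<nu> t x \<bullet> \<nu> t x = 0"
    using assms by (intro unit_vector_derivative_orthogonal[where S = I and u = "\<lambda>s. \<nu> s x"]
        norm_\<nu> time_not_bot has_vector_derivative_dt[OF T_pos] smooth_\<nu>)
  show "dx \<nu> t x \<bullet> \<nu> t x = 0"
    by (rule unit_vector_derivative_orthogonal[where S = UNIV])
      (use assms norm_\<nu> has_vector_derivative_dx[OF smooth_\<nu>] in auto)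
qed

text \<open>Differentiate \<open>\<nu> \<bullet> \<tau> = 0\<close> along the curve.\<close>

lemma \<kappa>_eq:
  assumes t: "t \<in> I"
  shows "\<kappa> t x = dx \<tau> t x \<bullet> \<nu> t x"
proof -
  have "((\<lambda>y. \<nu> t y \<bullet> \<tau> t y) has_real_derivative \<nu> t x \<bullet> dx \<tau> t x + dx \<nu> t x \<bullet> \<tau> t x) (at x)"
    by (intro has_vector_derivative_inner has_vector_derivative_dx[OF smooth_\<nu> t] \<tau>_has_dx[OF t])
  then show ?thesis
    using \<nu>_\<tau>[OF t] DERIV_unique[OF _ DERIV_const[of 0]] by (force simp: \<kappa>_def inner_commute)
qed

text \<open>\<open>dx \<tau>\<close> is purely normal because \<open>\<tau>\<close> has unit length,
  so the description defining \<open>curvature\<close> has a solution; it is unique because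
  \<open>\<nu>\<close> does not vanish.\<close>

lemma curvature_times_length:
  assumes t: "t \<in> I"
  shows "curvature F \<nu> t x * g t x = \<kappa> t x"
proof -
  have "dx \<tau> t x = \<kappa> t x *\<^sub>R \<nu> t x"
    using frame_expansion[OF t, of "dx \<tau> t x" x] \<tau>_has_dx(2)[OF t] by (simp add: \<kappa>_eq[OF t])
  then have "laplacian F F t x = (\<kappa> t x / g t x) *\<^sub>R \<nu> t x"
    by (simp add: laplacian_def ds_def[of F \<tau>] inverse_eq_divide)
  moreover have "\<nu> t x \<noteq> 0"
    using norm_\<nu>[OF t, of x] by auto
  ultimately have "curvature F \<nu> t x = \<kappa> t x / g t x"
    unfolding curvature_def by (intro the_equality) auto
  then show ?thesis
    using g_pos[OF t, of x] by simp
qed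

section \<open>Evolution of the curvature density and total curvature\<close>

text \<open>The other term of the product rule pairs \<open>dx \<nu>\<close>, which is tangential,
  with the time derivative of \<open>\<tau>\<close>, which is normal.\<close>

lemma \<kappa>_has_time_derivative:
  assumes t: "t \<in> I"
  shows "((\<lambda>s. \<kappa> s x) has_real_derivative - (dt T (dx \<nu>) t x \<bullet> \<tau> t x)) (at t within I)"
proof -
  obtain D where D: "((\<lambda>s. \<tau> s x) has_vector_derivative D) (at t within I)" "D \<bullet> \<tau> t x = 0"
    using \<tau>_has_time_derivative[OF t] .
  have "((\<lambda>s. \<kappa> s x) has_real_derivative
      - (dx \<nu> t x \<bullet> D + dt T (dx \<nu>) t x \<bullet> \<tau> t x)) (at t within I)"
    unfolding \<kappa>_def
    by (intro DERIV_minus has_vector_derivative_inner has_vector_derivative_dt[OF T_pos _ t]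
        smooth_family_intros D)
  moreover have "dx \<nu> t x \<bullet> D = 0"
    using inner_eq_zero_if_orthogonal_normal \<nu>_derivatives_orthogonal D(2) t by blast
  ultimately show ?thesis by simp
qed

text \<open>Compared with the time derivative of \<open>\<kappa>\<close>, this shows that the latter
  is an exact \<open>x\<close>-derivative, namely that of minus the turning speed of the
  normal.\<close>

lemma normal_rotation_has_dx:
  assumes t: "t \<in> I"
  shows "((\<lambda>y. dt T \<nu> t y \<bullet> \<tau> t y) has_real_derivative dt T (dx \<nu>) t x \<bullet> \<tau> t x) (at x within X)"
proof -
  have "((\<lambda>y. dt T \<nu> t y \<bullet> \<tau> t y) has_real_derivative
      dt T \<nu> t x \<bullet> dx \<tau> t x + dx (dt T \<nu>) t x \<bullet> \<tau> t x) (at x within X)"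
    by (intro has_vector_derivative_inner has_vector_derivative_dx[OF _ t] \<tau>_has_dx[OF t]
        smooth_family_intros)
  moreover have "dt T \<nu> t x \<bullet> dx \<tau> t x = 0"
    using inner_eq_zero_if_orthogonal_normal \<nu>_derivatives_orthogonal \<tau>_has_dx(2) t by blast
  ultimately show ?thesis
    by (simp add: dt_dx_commute[OF T_pos smooth_\<nu> t])
qed

lemma continuous_on_family:
  "smooth_circle_family T f \<Longrightarrow> continuous_on (I \<times> X) (\<lambda>p. f (fst p) (snd p))"
  using smooth_circle_family_continuous_on by (simp add: split_beta)

lemma continuous_on_\<tau>: "continuous_on (I \<times> X) (\<lambda>p. \<tau> (fst p) (snd p))"
  unfolding ds_def
  by (intro continuous_intros continuous_on_family smooth_family_intros)
    (use g_pos in fastforce)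

lemma continuous_on_\<kappa>: "continuous_on (I \<times> X) (\<lambda>p. \<kappa> (fst p) (snd p))"
  unfolding \<kappa>_def
  by (intro continuous_intros continuous_on_family continuous_on_\<tau> smooth_family_intros)

lemma continuous_on_slice:
  assumes "continuous_on (I \<times> X) (\<lambda>p. f (fst p) (snd p))" "t \<in> I"
  shows "continuous_on X (f t)"
proof -
  have "continuous_on X (\<lambda>x. (t, x))"
    by (intro continuous_intros)
  from continuous_on_compose2[OF assms(1) this] assms(2) show ?thesis
    by auto
qed

lemma periodic_\<tau>: "t \<in> I \<Longrightarrow> \<tau> t (x + 2 * pi) = \<tau> t x"
  using smooth_circle_family_dx[OF smooth_F] by (simp add: ds_def smooth_circle_family_def)

text \<open>After differentiation under the integral the integrand is an exact derivative, whose
  boundary terms cancel by periodicity. No flow equation enters.\<close>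

lemma total_curvature_constant:
  assumes "t \<in> I"
  shows "integral {0..2 * pi} (\<kappa> t) = integral {0..2 * pi} (\<kappa> 0)"
proof -
  have "((\<lambda>s. integral (cbox 0 (2 * pi)) (\<kappa> s)) has_real_derivative 0) (at s within I)"
    if s: "s \<in> I" for s
  proof -
    let ?R = "\<lambda>s x. dt T (dx \<nu>) s x \<bullet> \<tau> s x"
    have "((\<lambda>s. integral (cbox 0 (2 * pi)) (\<kappa> s)) has_real_derivative
        integral (cbox 0 (2 * pi)) (\<lambda>x. - ?R s x)) (at s within I)"
    proof (rule leibniz_rule_field_derivative)
      show "continuous_on (I \<times> cbox 0 (2 * pi)) (\<lambda>(t, x). - ?R t x)"
        unfolding split_beta
        by (intro continuous_intros continuous_on_family continuous_on_\<tau> smooth_family_intros)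
      show "\<kappa> r integrable_on cbox 0 (2 * pi)" if "r \<in> I" for r
        by (rule integrable_continuous[OF continuous_on_slice[OF continuous_on_\<kappa> that]])
    qed (rule \<kappa>_has_time_derivative s convex_time_interval | assumption)+
    moreover have "(?R s has_integral dt T \<nu> s (2 * pi) \<bullet> \<tau> s (2 * pi) - dt T \<nu> s 0 \<bullet> \<tau> s 0)
        {0..2 * pi}"
      by (intro fundamental_theorem_of_calculus)
        (use normal_rotation_has_dx[OF s] in
          \<open>simp_all add: has_real_derivative_iff_has_vector_derivative\<close>)
    moreover have "dt T \<nu> s (2 * pi) = dt T \<nu> s 0" "\<tau> s (2 * pi) = \<tau> s 0"
      using smooth_circle_family_dt[OF T_pos smooth_\<nu>] periodic_\<tau>[OF s, of 0] s
      by (auto simp: smooth_circle_family_def dest!: bspec[of _ _ s] spec[of _ 0])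
    ultimately show ?thesis
      by (simp add: integral_unique)
  qed
  from has_field_derivative_zero_constant[OF convex_time_interval this] show ?thesis
    using assms zero_in_I by force
qed

lemma rotation_number_eq:
  "2 * pi * rotation_number F \<nu> 0 = integral {0..2 * pi} (\<kappa> 0)"
  using curvature_times_length[OF zero_in_I] by (simp add: rotation_number_def)

end

section \<open>The flow equation and normality of the velocity\<close>

locale normal_HMCF_circle = immersed_circle_family +
  assumes flow: "normal_HMCF T F \<nu>"
begin

definition \<sigma> where "\<sigma> t x = dt T F t x \<bullet> \<nu> t x"

lemma flow_equation:
  assumes "t \<in> I"
  shows "dt T (dt T F) t x = (energy_density T F t x * curvature F \<nu> t x) *\<^sub>R \<nu> t x
    - grad F (energy_density T F) t x"
  using flow assms by (simp add: normal_HMCF_def)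

lemma dx_energy_density:
  assumes t: "t \<in> I"
  shows "dx (energy_density T F) t x = dt T F t x \<bullet> dx (dt T F) t x"
proof (rule dx_eqI)
  have "((\<lambda>y. dt T F t y \<bullet> dt T F t y) has_real_derivative
      dt T F t x \<bullet> dx (dt T F) t x + dx (dt T F) t x \<bullet> dt T F t x) (at x)"
    by (intro has_vector_derivative_inner has_vector_derivative_dx[OF _ t] smooth_family_intros)
  then have "((\<lambda>y. 1/2 * (dt T F t y \<bullet> dt T F t y + 1)) has_real_derivative
      1/2 * (dt T F t x \<bullet> dx (dt T F) t x + dx (dt T F) t x \<bullet> dt T F t x + 0)) (at x)"
    by (intro DERIV_cmult DERIV_add DERIV_const)
  then show "(energy_density T F t has_vector_derivative dt T F t x \<bullet> dx (dt T F) t x) (at x)"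
    by (simp add: energy_density_def[abs_def] power2_norm_eq_inner inner_commute
        has_real_derivative_iff_has_vector_derivative)
qed

text \<open>The curvature term is normal, so only the gradient of the energy density contributes;
  its pairing with \<open>dx F\<close> is the \<open>x\<close>-derivative of that density.\<close>

lemma acceleration_tangential:
  assumes t: "t \<in> I"
  shows "dt T (dt T F) t x \<bullet> dx F t x = - (dt T F t x \<bullet> dx (dt T F) t x)"
proof -
  have "\<tau> t x \<bullet> dx F t x = g t x"
    using norm_\<tau>[OF t, of x] by (simp add: inner_dx_F[OF t] norm_eq_1)
  moreover have "\<nu> t x \<bullet> dx F t x = 0"
    using \<nu>_\<tau>[OF t, of x] by (simp add: inner_dx_F[OF t])
  ultimately show ?thesis
    using g_pos[OF t, of x]
    by (simp add: flow_equation[OF t] inner_diff_left grad_def ds_def[of F "energy_density T F"]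
        dx_energy_density[OF t])
qed

lemma acceleration_normal:
  assumes t: "t \<in> I"
  shows "dt T (dt T F) t x \<bullet> \<nu> t x = energy_density T F t x * curvature F \<nu> t x"
  using norm_\<nu>[OF t, of x] \<nu>_\<tau>[OF t, of x]
  by (simp add: flow_equation[OF t] inner_diff_left grad_def norm_eq_1
      inner_commute[of "\<tau> t x"])

text \<open>In the time derivative of this product, \<open>acceleration_tangential\<close> and the
  symmetry of mixed derivatives make the two terms cancel; the initial condition gives the value
  0.\<close>

lemma velocity_orthogonal_tangent:
  assumes "t \<in> I"
  shows "dt T F t x \<bullet> dx F t x = 0"
proof -
  have "((\<lambda>s. dt T F s x \<bullet> dx F s x) has_real_derivative 0) (at s within I)" if s: "s \<in> I" for s
  proof -
    have "((\<lambda>s. dt T F s x \<bullet> dx F s x) has_real_derivative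
        dt T F s x \<bullet> dt T (dx F) s x + dt T (dt T F) s x \<bullet> dx F s x) (at s within I)"
      by (intro has_vector_derivative_inner has_vector_derivative_dt[OF T_pos _ s]
          smooth_family_intros)
    then show ?thesis
      by (simp add: acceleration_tangential[OF s] dt_dx_commute[OF T_pos smooth_F s])
  qed
  from has_field_derivative_zero_constant[OF convex_time_interval this]
  have "dt T F t x \<bullet> dx F t x = dt T F 0 x \<bullet> dx F 0 x"
    using assms zero_in_I by force
  also have "\<dots> = g 0 x * (dt T F 0 x \<bullet> \<tau> 0 x)"
    by (simp add: inner_dx_F[OF zero_in_I])
  also have "\<dots> = 0"
  proof -
    have "(dt T F 0 x \<bullet> \<tau> 0 x) *\<^sub>R \<tau> 0 x = 0"
      using flow by (simp add: normal_HMCF_def tangential_def)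
    then show ?thesis
      using norm_\<tau>[OF zero_in_I, of x] by auto
  qed
  finally show ?thesis .
qed

lemma velocity_normal:
  assumes t: "t \<in> I"
  shows "dt T F t x = \<sigma> t x *\<^sub>R \<nu> t x"
proof -
  have "dt T F t x \<bullet> \<tau> t x = 0"
    using velocity_orthogonal_tangent[OF t] by (simp add: ds_def)
  then show ?thesis
    using frame_expansion[OF t, of "dt T F t x" x] by (simp add: \<sigma>_def)
qed

section \<open>Evolution of normal speed, length element and energy element\<close>

lemma energy_density_eq:
  assumes t: "t \<in> I"
  shows "energy_density T F t x = ((\<sigma> t x)\<^sup>2 + 1) / 2"
  using norm_\<nu>[OF t] by (simp add: energy_density_def velocity_normal[OF t])

text \<open>The velocity is a multiple of \<open>\<nu>\<close> and hence orthogonal to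
  \<open>dt T \<nu>\<close>, so only the normal acceleration remains.\<close>

lemma \<sigma>_has_time_derivative:
  assumes t: "t \<in> I"
  shows "((\<lambda>s. \<sigma> s x) has_real_derivative ((\<sigma> t x)\<^sup>2 + 1) / 2 * (\<kappa> t x / g t x)) (at t within I)"
proof -
  have "((\<lambda>s. \<sigma> s x) has_real_derivative
      dt T F t x \<bullet> dt T \<nu> t x + dt T (dt T F) t x \<bullet> \<nu> t x) (at t within I)"
    unfolding \<sigma>_def
    by (intro has_vector_derivative_inner has_vector_derivative_dt[OF T_pos _ t]
        smooth_family_intros)
  moreover have "dt T F t x \<bullet> dt T \<nu> t x = 0"
    using \<nu>_derivatives_orthogonal(1)[OF t, of x] by (simp add: velocity_normal[OF t] inner_commute)
  moreover have "curvature F \<nu> t x = \<kappa> t x / g t x"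
    using g_pos[OF t, of x] by (simp flip: curvature_times_length[OF t])
  ultimately show ?thesis
    by (simp add: acceleration_normal[OF t] energy_density_eq[OF t])
qed

text \<open>The length element changes at rate \<open>dx (dt T F) \<bullet> \<tau>\<close>.
  Differentiating \<open>dt T F \<bullet> \<tau> = 0\<close> in \<open>x\<close> moves the
  derivative onto \<open>\<tau>\<close>, where it produces \<open>\<kappa>\<close>.\<close>

lemma g_has_time_derivative:
  assumes t: "t \<in> I"
  shows "((\<lambda>s. g s x) has_real_derivative - (\<sigma> t x * \<kappa> t x)) (at t within I)"
proof -
  have "((\<lambda>y. dt T F t y \<bullet> \<tau> t y) has_real_derivative
      dt T F t x \<bullet> dx \<tau> t x + dx (dt T F) t x \<bullet> \<tau> t x) (at x)"
    by (intro has_vector_derivative_inner has_vector_derivative_dx[OF _ t] \<tau>_has_dx[OF t]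
        smooth_family_intros)
  moreover have "(\<lambda>y. dt T F t y \<bullet> \<tau> t y) = (\<lambda>_. 0)"
    by (simp add: velocity_normal[OF t] \<nu>_\<tau>[OF t])
  ultimately have "dt T F t x \<bullet> dx \<tau> t x + dx (dt T F) t x \<bullet> \<tau> t x = 0"
    using DERIV_const DERIV_unique by metis
  then have "dx (dt T F) t x \<bullet> \<tau> t x = - (\<sigma> t x * (\<nu> t x \<bullet> dx \<tau> t x))"
    unfolding velocity_normal[OF t, of x] by simp
  also have "\<nu> t x \<bullet> dx \<tau> t x = \<kappa> t x"
    by (simp add: \<kappa>_eq[OF t] inner_commute)
  finally have "dx (dt T F) t x \<bullet> \<tau> t x = - (\<sigma> t x * \<kappa> t x)" .
  then have "(dx F t x \<bullet> dt T (dx F) t x) / g t x = - (\<sigma> t x * \<kappa> t x)"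
    by (simp add: ds_def inverse_eq_divide inner_commute[of "dx F t x"]
        dt_dx_commute[OF T_pos smooth_F t])
  moreover have "((\<lambda>s. g s x) has_real_derivative (dx F t x \<bullet> dt T (dx F) t x) / g t x) (at t within I)"
    using g_pos[OF t, of x] by (intro has_real_derivative_norm has_vector_derivative_dt[OF T_pos _ t]
        smooth_family_intros) auto
  ultimately show ?thesis
    by simp
qed

text \<open>With \<open>e\<close> the energy density, its growth contributes
  \<open>\<sigma> * e * \<kappa>\<close> and the shrinking of length
  \<open>- e * \<sigma> * \<kappa>\<close>.\<close>

lemma energy_element_constant:
  assumes "t \<in> I"
  shows "((\<sigma> t x)\<^sup>2 + 1) / 2 * g t x = ((\<sigma> 0 x)\<^sup>2 + 1) / 2 * g 0 x"
proof -
  have "((\<lambda>s. ((\<sigma> s x)\<^sup>2 + 1) / 2 * g s x) has_real_derivative 0) (at s within I)"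
    if s: "s \<in> I" for s
  proof -
    let ?e = "((\<sigma> s x)\<^sup>2 + 1) / 2"
    have "((\<lambda>s. ((\<sigma> s x)\<^sup>2 + 1) / 2) has_real_derivative \<sigma> s x * (?e * (\<kappa> s x / g s x)))
        (at s within I)"
      by (rule derivative_eq_intros \<sigma>_has_time_derivative[OF s] refl | simp)+
    from DERIV_mult[OF this g_has_time_derivative[OF s, of x]] show ?thesis
      using g_pos[OF s, of x] by simp
  qed
  from has_field_derivative_zero_constant[OF convex_time_interval this] show ?thesis
    using assms zero_in_I by force
qed

section \<open>A functional with linear growth, bounded by the energy\<close>

text \<open>A solution of \<open>\<Phi>'(s) (s\<^sup>2 + 1)/2 - s \<Phi>(s) = 1\<close>.\<close>

definition \<Phi> :: "real \<Rightarrow> real" where "\<Phi> s = s + (1 + s\<^sup>2) * arctan s"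

text \<open>The linear term is controlled by the arithmetic-geometric mean inequality, the other by
  \<open>pi / 2\<close> as a bound for arctan.\<close>

lemma abs_\<Phi>_le: "\<bar>\<Phi> s\<bar> \<le> (1 + pi) * ((s\<^sup>2 + 1) / 2)"
proof -
  have "0 \<le> (\<bar>s\<bar> - 1)\<^sup>2" by simp
  then have "\<bar>s\<bar> \<le> (s\<^sup>2 + 1) / 2"
    by (simp add: power2_diff)
  moreover have "\<bar>(1 + s\<^sup>2) * arctan s\<bar> \<le> (1 + s\<^sup>2) * (pi / 2)"
    unfolding abs_mult using arctan_bounded[of s] by (intro mult_mono) auto
  ultimately show ?thesis
    using abs_triangle_ineq[of s "(1 + s\<^sup>2) * arctan s"] by (simp add: \<Phi>_def algebra_simps)
qed

lemma \<Phi>_has_derivative: "(\<Phi> has_real_derivative 2 + 2 * s * arctan s) (at s)"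
proof -
  have "1 + s\<^sup>2 \<noteq> 0"
    by (metis add.commute power2_eq_square sum_squares_eq_zero_iff one_power2 zero_neq_one)
  then show ?thesis
    unfolding \<Phi>_def[abs_def] by (auto intro!: derivative_eq_intros simp: field_simps)
qed

text \<open>The product rule gives \<open>\<kappa>\<close> times the left-hand side of the
  differential equation solved by \<open>\<Phi>\<close>, evaluated at \<open>\<sigma>\<close>; that
  factor is 1.\<close>

lemma \<Phi>_element_has_time_derivative:
  assumes t: "t \<in> I"
  shows "((\<lambda>s. \<Phi> (\<sigma> s x) * g s x) has_real_derivative \<kappa> t x) (at t within I)"
proof -
  have "((\<lambda>s. \<Phi> (\<sigma> s x) * g s x) has_real_derivative
      ((2 + 2 * \<sigma> t x * arctan (\<sigma> t x)) * (((\<sigma> t x)\<^sup>2 + 1) / 2 * (\<kappa> t x / g t x))) * g t x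
      + - (\<sigma> t x * \<kappa> t x) * \<Phi> (\<sigma> t x)) (at t within I)"
    by (intro DERIV_mult DERIV_chain2[OF \<Phi>_has_derivative]
        \<sigma>_has_time_derivative[OF t] g_has_time_derivative[OF t])
  moreover have "((2 + 2 * \<sigma> t x * arctan (\<sigma> t x)) * (((\<sigma> t x)\<^sup>2 + 1) / 2 * (\<kappa> t x / g t x))) * g t x
      + - (\<sigma> t x * \<kappa> t x) * \<Phi> (\<sigma> t x) = \<kappa> t x"
    using g_pos[OF t, of x] by (simp add: \<Phi>_def field_simps power2_eq_square)
  ultimately show ?thesis by simp
qed

lemma continuous_on_\<sigma>: "continuous_on (I \<times> X) (\<lambda>p. \<sigma> (fst p) (snd p))"
  unfolding \<sigma>_def by (intro continuous_intros continuous_on_family smooth_family_intros)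

lemma continuous_on_\<sigma>_slice: "t \<in> I \<Longrightarrow> continuous_on X (\<sigma> t)"
  by (rule continuous_on_slice[OF continuous_on_\<sigma>])

lemma continuous_on_g_slice: "t \<in> I \<Longrightarrow> continuous_on X (g t)"
  by (rule continuous_on_norm[OF
        smooth_circle_family_continuous_on_slice[OF smooth_circle_family_dx[OF smooth_F]]])

lemma integral_\<Phi>_element:
  assumes "t \<in> I"
  defines "Q \<equiv> \<lambda>t. integral {0..2 * pi} (\<lambda>x. \<Phi> (\<sigma> t x) * g t x)"
  shows "Q t = Q 0 + t * (2 * pi * rotation_number F \<nu> 0)"
proof -
  let ?c = "2 * pi * rotation_number F \<nu> 0"
  \<comment> \<open>Subtracting the expected linear growth reduces the claim to constancy of a
    function with zero derivative on a convex set.\<close>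
  have "((\<lambda>s. Q s - s * ?c) has_real_derivative 0) (at s within I)" if s: "s \<in> I" for s
  proof -
    have "((\<lambda>s. integral (cbox 0 (2 * pi)) (\<lambda>x. \<Phi> (\<sigma> s x) * g s x)) has_real_derivative
        integral (cbox 0 (2 * pi)) (\<kappa> s)) (at s within I)"
    proof (rule leibniz_rule_field_derivative)
      show "(\<lambda>x. \<Phi> (\<sigma> r x) * g r x) integrable_on cbox 0 (2 * pi)" if "r \<in> I" for r
        unfolding \<Phi>_def
        by (intro integrable_continuous continuous_intros continuous_on_\<sigma>_slice
            continuous_on_g_slice that)
      show "continuous_on (I \<times> cbox 0 (2 * pi)) (\<lambda>(t, x). \<kappa> t x)"
        using continuous_on_\<kappa> by (simp add: split_beta)
    qed (rule \<Phi>_element_has_time_derivative s convex_time_interval | assumption)+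
    then have "(Q has_real_derivative ?c) (at s within I)"
      unfolding Q_def using total_curvature_constant[OF s] rotation_number_eq by simp
    then show ?thesis
      by (auto intro!: derivative_eq_intros)
  qed
  from has_field_derivative_zero_constant[OF convex_time_interval this]
  have "Q t - t * ?c = Q 0 - 0 * ?c"
    using assms(1) zero_in_I by metis
  then show ?thesis by simp
qed

text \<open>A bound on every time of existence by initial data alone. The factor 2 comes from
  estimating \<open>Q t\<close> and \<open>Q 0\<close> separately.\<close>

lemma existence_time_bound:
  assumes "t \<in> I"
  shows "t * \<bar>2 * pi * rotation_number F \<nu> 0\<bar> \<le>
    2 * (1 + pi) * integral {0..2 * pi} (\<lambda>x. ((\<sigma> 0 x)\<^sup>2 + 1) / 2 * g 0 x)"
proof -
  define Q where "Q t = integral {0..2 * pi} (\<lambda>x. \<Phi> (\<sigma> t x) * g t x)" for t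
  define E where "E = integral {0..2 * pi} (\<lambda>x. ((\<sigma> 0 x)\<^sup>2 + 1) / 2 * g 0 x)"
  have bound: "\<bar>Q s\<bar> \<le> (1 + pi) * E" if s: "s \<in> I" for s
  proof -
    have "norm (Q s) \<le>
        integral {0..2 * pi} (\<lambda>x. (1 + pi) * (((\<sigma> 0 x)\<^sup>2 + 1) / 2 * g 0 x))"
      unfolding Q_def
    proof (rule integral_norm_bound_integral)
      show "(\<lambda>x. \<Phi> (\<sigma> s x) * g s x) integrable_on {0..2 * pi}"
        unfolding \<Phi>_def
        by (intro integrable_continuous_real continuous_intros continuous_on_\<sigma>_slice
            continuous_on_g_slice s)
      show "(\<lambda>x. (1 + pi) * (((\<sigma> 0 x)\<^sup>2 + 1) / 2 * g 0 x)) integrable_on {0..2 * pi}"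
        by (intro integrable_continuous_real continuous_intros continuous_on_\<sigma>_slice
            continuous_on_g_slice zero_in_I) simp
      \<comment> \<open>The pointwise bound by the energy element at time \<open>s\<close> is
        carried back to time 0 by conservation.\<close>
      show "norm (\<Phi> (\<sigma> s x) * g s x) \<le> (1 + pi) * (((\<sigma> 0 x)\<^sup>2 + 1) / 2 * g 0 x)" for x
        using mult_right_mono[OF abs_\<Phi>_le, of "g s x" "\<sigma> s x"]
          energy_element_constant[OF s, of x] by (simp add: abs_mult mult.assoc)
    qed
    then show ?thesis by (simp add: E_def)
  qed
  have "t * \<bar>2 * pi * rotation_number F \<nu> 0\<bar> = \<bar>Q t - Q 0\<bar>"
    using integral_\<Phi>_element[OF assms] assms
    by (simp add: Q_def abs_mult time_interval_def)
  also have "\<dots> \<le> 2 * (1 + pi) * E"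
    using bound[OF assms] bound[OF zero_in_I] by linarith
  finally show ?thesis by (simp add: E_def)
qed

end

theorem proposition7p3:
  fixes T :: ereal and F \<nu> :: "real \<Rightarrow> real \<Rightarrow> real^2"
  assumes "0 < T"
    and "smooth_immersions T F"
    and "smooth_unit_normal T F \<nu>"
    and "normal_HMCF T F \<nu>"
    and "rotation_number F \<nu> 0 \<noteq> 0"
  shows "T < \<infinity>"
proof (rule ccontr)
  assume "\<not> T < \<infinity>"
  interpret normal_HMCF_circle T F \<nu>
    by unfold_locales (fact assms)+
  define c where "c = \<bar>2 * pi * rotation_number F \<nu> 0\<bar>"
  define B where "B = 2 * (1 + pi) * integral {0..2 * pi} (\<lambda>x. ((\<sigma> 0 x)\<^sup>2 + 1) / 2 * g 0 x)"
  have "0 < c"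
    using assms(5) by (simp add: c_def)
  \<comment> \<open>With infinite lifetime every nonnegative \<open>t\<close> lies in the time
    interval.\<close>
  have bound: "t * c \<le> B" if "0 \<le> t" for t
    unfolding c_def B_def
    by (rule existence_time_bound) (use that \<open>\<not> T < \<infinity>\<close> in \<open>simp add: time_interval_def\<close>)
  have "0 \<le> B"
    using bound[of 0] by simp
  \<comment> \<open>This time is nonnegative because \<open>0 \<le> B\<close>, and the bound there
    reads \<open>B + 1 \<le> B\<close>.\<close>
  with \<open>0 < c\<close> bound[of "(B + 1) / c"] show False
    by simp
qed

end
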